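(* Let $f(x),g(x)\in\mathbb{Z}[x]$ be polynomials of positive degree having no common complex root, and let $d=\gcd(L(f),L(g))$, where $L(h)$ denotes the leading coefficient of $h$. Let $R(f,g)=|\mathrm{Res}(f,g)|$. Then there are unique integer polynomials $p(x),q(x)\in\mathbb{Z}[x]$ such that $\deg(p)<\deg(g)$, $\deg(q)<\deg(f)$, $d\mid \mathrm{cont}(p)$, $d\mid\mathrm{cont}(q)$, and $$p(x)f(x)+q(x)g(x)=R(f,g).$$ In particular, $d\mid R(f,g)$.
   Context: $\mathrm{Res}(f,g)$ is the resultant of $f$ and $g$ (the determinant of their Sylvester matrix). For $h\in\mathbb{Z}[x]$, $\mathrm{cont}(h)$ is the greatest common divisor of the coefficients of $h$. *)

theory Defs
  imports Complex_Main "Subresultants.Resultant_Prelim"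
begin

end

theory Submission
  imports Defs "HOL-Computational_Algebra.Field_as_Ring"
    "HOL-Computational_Algebra.Fundamental_Theorem_Algebra"
begin

text \<open>
  The last row of the adjugate of the Sylvester matrix \<open>S\<close> solves \<open>v S = (0, \<dots>, 0, det S)\<close>;
  since the rows of \<open>S\<close> are the coefficient vectors of the shifts \<open>x\<^sup>i f\<close> and \<open>x\<^sup>i g\<close>, its entries
  are the coefficients of Bezout cofactors of the resultant. Each entry is, up to sign, a minor
  that retains the first column of \<open>S\<close>, whose only nonzero entries are the two leading
  coefficients, so it is divisible by their gcd. Uniqueness holds because \<open>f\<close> and \<open>g\<close> are coprime
  over the complex numbers.
\<close>

lemma sum_lessThan_add:
  fixes h :: "nat \<Rightarrow> 'a :: comm_monoid_add"
  shows "sum h {..<a + b} = sum h {..<a} + (\<Sum>i<b. h (a + i))"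
  by (induction b) (simp_all add: add.assoc)

lemma det_dvd_of_dvd_column:
  fixes A :: "'a :: comm_ring_1 mat"
  assumes "A \<in> carrier_mat n n" and "j < n" and "\<And>i. i < n \<Longrightarrow> d dvd A $$ (i, j)"
  shows "d dvd det A"
  unfolding laplace_expansion_column[OF assms(1,2)]
  by (intro dvd_sum dvd_mult2) (use assms(3) in auto)

text \<open>Since \<open>0 < j\<close>, column 0 survives the deletion: row \<open>k\<close> of the
  minor starts with the first entry of row \<open>k\<close> or \<open>Suc k\<close> of
  \<open>A\<close>.\<close>

lemma cofactor_dvd_of_dvd_column_0:
  fixes A :: "'a :: comm_ring_1 mat"
  assumes A: "A \<in> carrier_mat n n" and i: "i < n" and j: "0 < j" "j < n"
    and dvd: "\<And>k. k < n \<Longrightarrow> d dvd A $$ (k, 0)"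
  shows "d dvd cofactor A i j"
proof -
  have "d dvd det (mat_delete A i j)"
  proof (rule det_dvd_of_dvd_column)
    show "mat_delete A i j \<in> carrier_mat (n - 1) (n - 1)"
      using A by (rule mat_delete_carrier)
    show "0 < n - 1" using j by auto
    fix k assume "k < n - 1"
    then show "d dvd mat_delete A i j $$ (k, 0)"
      using A j dvd[of k] dvd[of "Suc k"] unfolding mat_delete_def by auto
  qed
  then show ?thesis by (simp add: cofactor_def)
qed

text \<open>Only the first row of each block, row 0 for \<open>f\<close> and row
  \<open>degree g\<close> for \<open>g\<close>, reaches the column of the highest power.\<close>

lemma sylvester_mat_dvd_column_0:
  fixes f g :: "'a :: comm_ring_1 poly"
  assumes "d dvd lead_coeff f" "d dvd lead_coeff g"
    and k: "k < degree f + degree g"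
  shows "d dvd sylvester_mat f g $$ (k, 0)"
proof -
  have "0 < degree f + degree g" using k by linarith
  then show ?thesis
    using assms by (cases "k = degree g") (auto simp: sylvester_index_mat)
qed

text \<open>This is the \<open>(j, k)\<close> entry of the identity "adjugate times \<open>A\<close>
  equals \<open>det A\<close> times the unit matrix".\<close>

lemma sum_cofactor_mult_column:
  fixes A :: "'a :: comm_ring_1 mat"
  assumes A: "A \<in> carrier_mat n n" and j: "j < n" and k: "k < n"
  shows "(\<Sum>i<n. cofactor A i j * A $$ (i, k)) = (if j = k then det A else 0)"
proof -
  have "(adj_mat A * A) $$ (j, k) = (\<Sum>i<n. cofactor A i j * A $$ (i, k))"
    using A j k by (auto simp: scalar_prod_def adj_mat_def atLeast0LessThan)
  moreover have "(adj_mat A * A) $$ (j, k) = (if j = k then det A else 0)"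
    using A j k by (simp add: adj_mat(3)[OF A])
  ultimately show ?thesis by simp
qed

text \<open>The cofactors along the last column form the last row of the adjugate. Row
  \<open>i\<close> of the Sylvester matrix lists the coefficients of
  \<open>x^(degree g - 1 - i) * f\<close>, highest power first; hence the exponent.\<close>

definition bezout_left :: "'a :: comm_ring_1 poly \<Rightarrow> 'a poly \<Rightarrow> 'a poly" where
  "bezout_left f g = (\<Sum>i<degree g.
     monom (cofactor (sylvester_mat f g) i (degree f + degree g - 1)) (degree g - 1 - i))"

definition bezout_right :: "'a :: comm_ring_1 poly \<Rightarrow> 'a poly \<Rightarrow> 'a poly" where
  "bezout_right f g = (\<Sum>i<degree f.
     monom (cofactor (sylvester_mat f g) (degree g + i) (degree f + degree g - 1))
       (degree f - 1 - i))"

lemma degree_bezout_left_less: "degree g > 0 \<Longrightarrow> degree (bezout_left f g) < degree g"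
  unfolding bezout_left_def
  by (intro degree_sum_less) (auto intro: le_less_trans[OF degree_monom_le])

lemma degree_bezout_right_less: "degree f > 0 \<Longrightarrow> degree (bezout_right f g) < degree f"
  unfolding bezout_right_def
  by (intro degree_sum_less) (auto intro: le_less_trans[OF degree_monom_le])

theorem bezout_resultant:
  fixes f g :: "'a :: comm_ring_1 poly"
  assumes f: "degree f > 0" and g: "degree g > 0"
  shows "bezout_left f g * f + bezout_right f g * g = [:resultant f g:]"
proof (rule poly_eqI)
  fix k
  define m n N S where "m = degree f" and "n = degree g" and "N = m + n"
    and "S = sylvester_mat f g"
  define c where "c = (\<lambda>i. cofactor S i (N - 1))"
  have S: "S \<in> carrier_mat N N" unfolding S_def N_def m_def n_def by (rule sylvester_carrier_mat)
  have N: "N > 0" "m > 0" "n > 0" using f g by (auto simp: N_def m_def n_def)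
  have p: "bezout_left f g = (\<Sum>i<n. monom (c i) (n - 1 - i))"
    unfolding bezout_left_def c_def S_def N_def m_def n_def ..
  have q: "bezout_right f g = (\<Sum>i<m. monom (c (n + i)) (m - 1 - i))"
    unfolding bezout_right_def c_def S_def N_def m_def n_def ..
  show "coeff (bezout_left f g * f + bezout_right f g * g) k = coeff [:resultant f g:] k"
  proof (cases "k < N")
    case True
    \<comment> \<open>\<open>sylvester_index_mat2\<close> describes the entries with one extra
      factor \<open>x\<close> and the coefficient index raised by one; this converts to that
      form.\<close>
    have coeff_shift: "coeff (monom c e * h) k = c * coeff (monom 1 (Suc e) * h) (Suc k)"
      for c e and h :: "'a poly"
      by (simp add: coeff_monom_mult)
    have left: "coeff (monom (c i) (n - 1 - i) * f) k = c i * S $$ (i, N - 1 - k)"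
      if "i < n" for i
      using that True coeff_shift[of "c i" "n - 1 - i" f] unfolding S_def
      by (subst sylvester_index_mat2) (auto simp: N_def m_def n_def Suc_diff_Suc)
    have right: "coeff (monom (c (n + i)) (m - 1 - i) * g) k = c (n + i) * S $$ (n + i, N - 1 - k)"
      if "i < m" for i
      using that True coeff_shift[of "c (n + i)" "m - 1 - i" g] unfolding S_def
      by (subst sylvester_index_mat2) (auto simp: N_def m_def n_def Suc_diff_Suc)
    have "coeff (bezout_left f g * f + bezout_right f g * g) k
        = (\<Sum>i<n. c i * S $$ (i, N - 1 - k)) + (\<Sum>i<m. c (n + i) * S $$ (n + i, N - 1 - k))"
      unfolding p q coeff_add sum_distrib_right coeff_sum
      by (intro arg_cong2[of _ _ _ _ "(+)"] sum.cong refl left right) auto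
    also have "\<dots> = (\<Sum>i<N. c i * S $$ (i, N - 1 - k))"
      unfolding N_def add.commute[of m n] by (rule sum_lessThan_add[symmetric])
    \<comment> \<open>Column \<open>N - 1 - k\<close> holds the coefficients of \<open>x^k\<close>,
      so it is the last column exactly when \<open>k = 0\<close>: only the constant term
      survives.\<close>
    also have "\<dots> = (if N - 1 = N - 1 - k then det S else 0)"
      unfolding c_def using N True by (intro sum_cofactor_mult_column[OF S]) auto
    also have "\<dots> = coeff [:resultant f g:] k"
      using N True by (auto simp: resultant_def S_def coeff_pCons split: nat.split)
    finally show ?thesis .
  next
    case False
    have "degree (bezout_left f g * f) < N" "degree (bezout_right f g * g) < N"
      using degree_bezout_left_less[OF g, of f] degree_bezout_right_less[OF f, of g]
        degree_mult_le[of "bezout_left f g" f] degree_mult_le[of "bezout_right f g" g]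
      by (auto simp: N_def m_def n_def)
    then show ?thesis
      using False N by (auto simp: coeff_eq_0 coeff_pCons split: nat.split)
  qed
qed

lemma dvd_content_iff: "d dvd content h \<longleftrightarrow> (\<forall>i. d dvd coeff h i)"
  using const_poly_dvd_iff_dvd_content[of d h] const_poly_dvd_iff[of d h] by simp

lemma
  fixes f g :: "'a :: {comm_ring_1,semiring_gcd} poly"
  assumes f: "degree f > 0" and g: "degree g > 0"
    and d: "d dvd lead_coeff f" "d dvd lead_coeff g"
  shows dvd_content_bezout_left: "d dvd content (bezout_left f g)"
    and dvd_content_bezout_right: "d dvd content (bezout_right f g)"
    and dvd_resultant: "d dvd resultant f g"
proof -
  define N where "N = degree f + degree g"
  \<comment> \<open>Both degrees are positive, so \<open>N\<close> is at least 2 and the deleted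
    last column is not column 0.\<close>
  have N: "0 < N - 1" "N - 1 < N" using f g by (auto simp: N_def)
  have S: "sylvester_mat f g \<in> carrier_mat N N"
    unfolding N_def by (rule sylvester_carrier_mat)
  have column: "d dvd sylvester_mat f g $$ (k, 0)" if "k < N" for k
    using sylvester_mat_dvd_column_0[OF d, of k] that by (simp add: N_def)
  have cof: "d dvd cofactor (sylvester_mat f g) i (degree f + degree g - 1)"
    if "i < degree f + degree g" for i
    using cofactor_dvd_of_dvd_column_0[OF S _ N column] that by (simp add: N_def)
  show "d dvd content (bezout_left f g)"
    unfolding dvd_content_iff bezout_left_def coeff_sum by (auto intro!: dvd_sum cof simp del: One_nat_def)
  show "d dvd content (bezout_right f g)"
    unfolding dvd_content_iff bezout_right_def coeff_sum by (auto intro!: dvd_sum cof simp del: One_nat_def)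
  show "d dvd resultant f g"
    unfolding resultant_def using N by (intro det_dvd_of_dvd_column[OF S _ column]) auto
qed

text \<open>A root of a common divisor would be a common root, so by the fundamental theorem of
  algebra common divisors are constant; \<open>f \<noteq> 0\<close> makes them nonzero, hence
  units.\<close>

lemma coprime_complex_poly:
  fixes f g :: "complex poly"
  assumes "\<not> (\<exists>z. poly f z = 0 \<and> poly g z = 0)" and "f \<noteq> 0"
  shows "coprime f g"
proof (rule coprimeI)
  fix c assume c: "c dvd f" "c dvd g"
  have "\<not> (\<exists>z. poly c z = 0)" using c assms(1) by (auto elim!: dvdE)
  then have "constant (poly c)"
    using fundamental_theorem_of_algebra by blast
  then have "degree c = 0" by (simp add: constant_degree)
  moreover have "c \<noteq> 0" using c assms(2) by auto
  ultimately show "is_unit c" by (simp add: is_unit_iff_degree)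
qed

text \<open>Serves uniqueness, with \<open>u\<close> and \<open>v\<close> differences of cofactors.
  Over the complex numbers \<open>g\<close> divides \<open>u * f\<close> and is coprime to
  \<open>f\<close>, so it divides \<open>u\<close>, which has smaller degree.\<close>

lemma eq_0_of_mult_eq_mult_coprime:
  fixes u v f g :: "int poly"
  assumes eq: "u * f = v * g" and u: "degree u < degree g"
    and no_root: "\<not> (\<exists>z::complex. poly (of_int_poly f) z = 0 \<and> poly (of_int_poly g) z = 0)"
  shows "u = 0"
proof (rule ccontr)
  assume "u \<noteq> 0"
  let ?c = "of_int_poly :: int poly \<Rightarrow> complex poly"
  have "?c g \<noteq> 0" using u by auto
  then have "coprime (?c g) (?c f)"
    using no_root by (intro coprime_complex_poly) auto
  moreover have "?c u * ?c f = ?c v * ?c g"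
    using arg_cong[OF eq, of ?c] by (simp add: of_int_poly_hom.hom_mult)
  then have "?c g dvd ?c u * ?c f" by simp
  ultimately have "?c g dvd ?c u" by (simp add: coprime_dvd_mult_left_iff)
  moreover have "?c u \<noteq> 0" using \<open>u \<noteq> 0\<close> by simp
  ultimately have "degree (?c g) \<le> degree (?c u)" by (rule dvd_imp_degree_le)
  then show False using u by simp
qed

theorem theorem2p1:
  fixes f g :: "int poly" and d R :: int
  assumes f_pos: "degree f > 0" and g_pos: "degree g > 0"
    and no_common_root:
      "\<not> (\<exists>z::complex. poly (of_int_poly f) z = 0 \<and> poly (of_int_poly g) z = 0)"
    and d_eq: "d = gcd (lead_coeff f) (lead_coeff g)"
    and R_eq: "R = \<bar>resultant f g\<bar>"
  shows "(\<exists>!(p, q). degree p < degree g \<and> degree q < degree f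
            \<and> d dvd content p \<and> d dvd content q
            \<and> p * f + q * g = [:R:])
         \<and> d dvd R"
proof
  have d: "d dvd lead_coeff f" "d dvd lead_coeff g" by (simp_all add: d_eq)
  show "d dvd R" using dvd_resultant[OF f_pos g_pos d] by (simp add: R_eq)
  \<comment> \<open>Multiplying by the sign turns the resultant into its absolute value and
    preserves the degree bounds and the divisibility by \<open>d\<close>.\<close>
  define s where "s = sgn (resultant f g)"
  define p q where "p = smult s (bezout_left f g)" and "q = smult s (bezout_right f g)"
  have "p * f + q * g = smult s [:resultant f g:]"
    unfolding p_def q_def bezout_resultant[OF f_pos g_pos, symmetric]
    by (simp add: smult_add_right)
  then have pq: "p * f + q * g = [:R:]"
    by (simp add: R_eq s_def abs_sgn mult.commute)
  have deg: "degree p < degree g" "degree q < degree f"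
    using degree_bezout_left_less[OF g_pos, of f] degree_bezout_right_less[OF f_pos, of g]
    by (auto simp: p_def q_def)
  have dvd: "d dvd content p" "d dvd content q"
    using dvd_content_bezout_left[OF f_pos g_pos d] dvd_content_bezout_right[OF f_pos g_pos d]
    by (simp_all add: p_def q_def)
  show "\<exists>!(p, q). degree p < degree g \<and> degree q < degree f
            \<and> d dvd content p \<and> d dvd content q \<and> p * f + q * g = [:R:]"
  proof (rule ex1I[of _ "(p, q)"]; clarsimp)
    show "degree p < degree g \<and> degree q < degree f
        \<and> d dvd content p \<and> d dvd content q \<and> p * f + q * g = [:R:]"
      using deg dvd pq by simp
  next
    fix p' q'
    assume deg': "degree p' < degree g" and eq: "p' * f + q' * g = [:R:]"
    \<comment> \<open>Subtracting the two identities cancels \<open>R\<close>. Once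
      \<open>p' = p\<close>, the left side vanishes and the nonzero factor \<open>g\<close> forces
      \<open>q' = q\<close>.\<close>
    have "(p' - p) * f = (q - q') * g"
      using eq pq by (simp add: algebra_simps)
    then have "p' - p = 0"
      using no_common_root deg deg' by (intro eq_0_of_mult_eq_mult_coprime[of _ f _ g])
        (auto intro: degree_diff_less)
    moreover from this \<open>(p' - p) * f = (q - q') * g\<close> have "q' = q"
      using g_pos by auto
    ultimately show "p' = p \<and> q' = q" by simp
  qed
qed

end
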